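(* Let $m\geq 4$ be an even integer and let $d$ be an integer with $1\leq d\leq \frac{m}{2}+2$. Then $\tau_{d}(P_m\square C_3)=3d$.
   Context: All graphs are simple, finite and undirected. A matching of a graph $G$ is a set of edges no two of which share an endpoint; a maximum matching is a matching of largest cardinality, and this cardinality is denoted $\nu(G)$. For an integer $d$ with $1\leq d\leq \nu(G)$, a $d$-transversal set of $G$ is a set $T\subseteq E(G)$ such that $|T\cap M|\geq d$ for every maximum matching $M$ of $G$; $\tau_d(G)$ denotes the minimum cardinality of a $d$-transversal set of $G$. $P_m$ is the path with $m$ vertices, $C_3$ is the cycle with $3$ vertices. The Cartesian product $G\square H$ has vertex set $V(G)\times V(H)$, with $(g_1,h_1)$ and $(g_2,h_2)$ adjacent iff either $g_1=g_2$ and $h_1h_2\in E(H)$, or $g_1g_2\in E(G)$ and $h_1=h_2$. *)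

theory Defs
  imports Main
begin

record 'a ugraph =
  verts :: "'a set"
  edges :: "'a set set"

definition finite_simple_graph :: "'a ugraph \<Rightarrow> bool" where
  "finite_simple_graph G \<longleftrightarrow> finite (verts G) \<and> (\<forall>e\<in>edges G. e \<subseteq> verts G \<and> card e = 2)"

definition matching :: "'a ugraph \<Rightarrow> 'a set set \<Rightarrow> bool" where
  "matching G M \<longleftrightarrow> M \<subseteq> edges G \<and> (\<forall>e\<in>M. \<forall>f\<in>M. e \<noteq> f \<longrightarrow> e \<inter> f = {})"

definition matching_number :: "'a ugraph \<Rightarrow> nat" where
  "matching_number G = Max (card ` {M. matching G M})"

definition maximum_matching :: "'a ugraph \<Rightarrow> 'a set set \<Rightarrow> bool" where
  "maximum_matching G M \<longleftrightarrow> matching G M \<and> card M = matching_number G"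

text \<open>The notion is only defined for \<open>1 \<le> d \<le> matching_number G\<close>; outside
  this range no set counts as a \<open>d\<close>-transversal set and \<open>transversal_number\<close> is
  unspecified. Inside it, \<open>edges G\<close> itself is one, so \<open>Min\<close> is taken over
  a nonempty finite set whenever \<open>G\<close> is finite and simple.\<close>

definition transversal_set :: "'a ugraph \<Rightarrow> nat \<Rightarrow> 'a set set \<Rightarrow> bool" where
  "transversal_set G d T \<longleftrightarrow> 1 \<le> d \<and> d \<le> matching_number G \<and> T \<subseteq> edges G \<and>
     (\<forall>M. maximum_matching G M \<longrightarrow> d \<le> card (T \<inter> M))"

definition transversal_number :: "nat \<Rightarrow> 'a ugraph \<Rightarrow> nat" where
  "transversal_number d G = Min (card ` {T. transversal_set G d T})"

definition path_graph :: "nat \<Rightarrow> nat ugraph" where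
  "path_graph m = \<lparr>verts = {..<m}, edges = {{i, Suc i} | i. Suc i < m}\<rparr>"

text \<open>Meaningful for \<open>n \<ge> 3\<close> only; for smaller \<open>n\<close> the result is not a simple cycle.\<close>

definition cycle_graph :: "nat \<Rightarrow> nat ugraph" where
  "cycle_graph n = \<lparr>verts = {..<n}, edges = {{i, Suc i mod n} | i. i < n}\<rparr>"

definition cartesian_product :: "'a ugraph \<Rightarrow> 'b ugraph \<Rightarrow> ('a \<times> 'b) ugraph" (infixl "\<box>" 70) where
  "G \<box> H = \<lparr>verts = verts G \<times> verts H,
     edges = {{(g1, h1), (g2, h2)} | g1 h1 g2 h2.
       (g1, h1) \<in> verts G \<times> verts H \<and> (g2, h2) \<in> verts G \<times> verts H \<and>
       (g1 = g2 \<and> {h1, h2} \<in> edges H \<or> {g1, g2} \<in> edges G \<and> h1 = h2)}\<rparr>"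

lemma finite_simple_graph_path: "finite_simple_graph (path_graph m)"
  by (auto simp: finite_simple_graph_def path_graph_def)

lemma finite_simple_graph_cycle:
  assumes "n \<ge> 3"
  shows "finite_simple_graph (cycle_graph n)"
proof -
  have "i \<noteq> Suc i mod n" if "i < n" for i
    using assms that by (cases "Suc i = n") auto
  then show ?thesis
    using assms by (auto simp: finite_simple_graph_def cycle_graph_def card_insert_if)
qed

lemma finite_simple_graph_cartesian_product:
  assumes "finite_simple_graph G" and "finite_simple_graph H"
  shows "finite_simple_graph (G \<box> H)"
proof -
  have *: "x \<noteq> y" if "{x, y} \<in> edges K" "finite_simple_graph K" for x y :: 'c and K
    using that by (auto simp: finite_simple_graph_def)
  show ?thesis
    using assms *[of _ _ G] *[of _ _ H]
    by (auto simp: finite_simple_graph_def cartesian_product_def card_insert_if)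
qed

end

theory Submission
  imports Defs
begin

text \<open>
  The \<open>m\<close> copies of the triangle are called layers, and the three edges joining two consecutive
  layers form a ladder. Since \<open>m\<close> is even, the graph has a perfect matching, so its maximum
  matchings are exactly the perfect ones (\<open>maximum_matching_iff_perfect\<close>).

  Lower bound: the layers \<open>2 * k\<close> and \<open>2 * k + 1\<close> induce a triangular prism, whose edges
  contain three disjoint perfect matchings: for each \<open>i < 3\<close>, the rung at position \<open>i\<close>
  together with the two triangle edges that avoid position \<open>i\<close>. Taking the same \<open>i\<close> in every
  prism gives three disjoint perfect matchings of the whole graph (\<open>slice_matching\<close>). A
  \<open>d\<close>-transversal set has at least \<open>d\<close> edges in each of them, hence at least \<open>3 * d\<close> edges.

  Upper bound: for even \<open>j\<close> the layers \<open>0, \<dots>, j\<close> have an odd number of vertices altogether, so a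
  perfect matching uses a rung of the ladder between the layers \<open>j\<close> and \<open>j + 1\<close>. The \<open>m div 2\<close>
  ladders of this kind are disjoint and have three edges each, so any \<open>d\<close> of them settle
  \<open>d \<le> m div 2\<close>. The two remaining values come from the end layers: an end layer has three vertices
  and all its edges lie in its triangle or its only ladder, so a perfect matching uses at least
  two of these six edges. Adding the triangle of an end layer to its ladder therefore costs three
  edges and gains one.
\<close>

section \<open>Perfect matchings\<close>

lemma finite_edges:
  assumes "finite_simple_graph G"
  shows "finite (edges G)"
proof (rule finite_subset)
  show "edges G \<subseteq> Pow (verts G)"
    using assms by (auto simp: finite_simple_graph_def)
  show "finite (Pow (verts G))"
    using assms by (simp add: finite_simple_graph_def)
qed

lemma matching_subset: "matching G M \<Longrightarrow> N \<subseteq> M \<Longrightarrow> matching G N"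
  unfolding matching_def by blast

lemma matching_subset_edges: "matching G M \<Longrightarrow> M \<subseteq> edges G"
  by (simp add: matching_def)

lemma finite_matching:
  "finite_simple_graph G \<Longrightarrow> matching G M \<Longrightarrow> finite M"
  using finite_edges finite_subset matching_subset_edges by metis

lemma Union_matching_subset:
  "finite_simple_graph G \<Longrightarrow> matching G M \<Longrightarrow> \<Union>M \<subseteq> verts G"
  unfolding finite_simple_graph_def matching_def by blast

lemma card_Union_matching:
  assumes G: "finite_simple_graph G" and M: "matching G M"
  shows "card (\<Union>M) = 2 * card M"
proof -
  have two: "card e = 2" if "e \<in> M" for e
    using assms that by (auto simp: finite_simple_graph_def matching_def)
  then have fin: "finite e" if "e \<in> M" for e
    using that card.infinite by fastforce
  have "card (\<Union>M) = sum card M"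
    using M fin by (intro card_Union_disjoint)
      (auto simp: pairwise_def disjnt_def matching_def)
  with two show ?thesis
    by simp
qed

lemma maximum_matching_iff_perfect:
  assumes G: "finite_simple_graph G" and N: "matching G N" "\<Union>N = verts G"
  shows "maximum_matching G M \<longleftrightarrow> matching G M \<and> \<Union>M = verts G"
    and "2 * matching_number G = card (verts G)"
proof -
  have fin: "finite (verts G)"
    using G by (simp add: finite_simple_graph_def)
  have le: "card M' \<le> card N" if "matching G M'" for M'
  proof -
    have "card (\<Union>M') \<le> card (\<Union>N)"
      using Union_matching_subset[OF G that] fin N by (metis card_mono)
    then show ?thesis
      using card_Union_matching[OF G] that N(1) by simp
  qed
  have num: "matching_number G = card N"
    unfolding matching_number_def
  proof (rule Max_eqI)
    show "finite (card ` {M. matching G M})"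
      by (rule finite_subset[of _ "{..card N}"]) (use le in blast, simp)
  next
    show "c \<le> card N" if "c \<in> card ` {M. matching G M}" for c
      using that le by blast
  next
    show "card N \<in> card ` {M. matching G M}"
      using N(1) by blast
  qed
  show twice: "2 * matching_number G = card (verts G)"
    using num card_Union_matching[OF G N(1)] N(2) by simp
  show "maximum_matching G M \<longleftrightarrow> matching G M \<and> \<Union>M = verts G"
  proof
    assume max: "maximum_matching G M"
    then have M: "matching G M" and "card M = matching_number G"
      by (auto simp: maximum_matching_def)
    then have "card (\<Union>M) = card (verts G)"
      using card_Union_matching[OF G M] twice by simp
    with M show "matching G M \<and> \<Union>M = verts G"
      using card_subset_eq[OF fin Union_matching_subset[OF G M]] by simp
  next
    assume "matching G M \<and> \<Union>M = verts G"
    then show "maximum_matching G M"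
      using card_Union_matching[OF G, of M] twice by (simp add: maximum_matching_def)
  qed
qed

text \<open>Otherwise the edges inside \<open>W\<close> would partition \<open>W\<close> into pairs.\<close>

lemma perfect_matching_crosses_odd_set:
  assumes G: "finite_simple_graph G" and M: "matching G M" "\<Union>M = verts G"
    and W: "W \<subseteq> verts G" "odd (card W)"
  shows "\<exists>e\<in>M. e \<inter> W \<noteq> {} \<and> \<not> e \<subseteq> W"
proof (rule ccontr)
  assume "\<not> ?thesis"
  then have inside: "e \<subseteq> W" if "e \<in> M" "x \<in> e" "x \<in> W" for e x
    using that by blast
  have "W = \<Union>{e \<in> M. e \<subseteq> W}"
  proof (intro equalityI subsetI)
    fix x assume x: "x \<in> W"
    then have "x \<in> \<Union>M"
      using M(2) W(1) by auto
    then obtain e where "e \<in> M" "x \<in> e"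
      by (elim UnionE)
    with x inside show "x \<in> \<Union>{e \<in> M. e \<subseteq> W}"
      by blast
  qed blast
  moreover have "card (\<Union>{e \<in> M. e \<subseteq> W}) = 2 * card {e \<in> M. e \<subseteq> W}"
    by (rule card_Union_matching[OF G matching_subset[OF M(1)]]) blast
  ultimately have "card W = 2 * card {e \<in> M. e \<subseteq> W}"
    by simp
  with W(2) show False
    by simp
qed

lemma perfect_matching_covers:
  assumes G: "finite_simple_graph G" and M: "matching G M" "\<Union>M = verts G"
    and W: "W \<subseteq> verts G"
  shows "card W \<le> 2 * card {e \<in> M. e \<inter> W \<noteq> {}}"
proof -
  let ?N = "{e \<in> M. e \<inter> W \<noteq> {}}"
  have N: "matching G ?N"
    by (rule matching_subset[OF M(1)]) blast
  have "finite (\<Union>?N)"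
    using Union_matching_subset[OF G N] G finite_subset
    by (auto simp: finite_simple_graph_def)
  moreover have "W \<subseteq> \<Union>?N"
    using M(2) W by blast
  ultimately show ?thesis
    using card_Union_matching[OF G N] card_mono by metis
qed

section \<open>Transversal sets\<close>

text \<open>A transversal set pays \<open>d\<close> edges separately to each member of a disjoint family of
  maximum matchings.\<close>

lemma card_transversal_set_ge:
  assumes G: "finite_simple_graph G" and T: "transversal_set G d T" and I: "finite I"
    and N: "\<And>i. i \<in> I \<Longrightarrow> maximum_matching G (N i)"
    and disj: "\<And>i j. i \<in> I \<Longrightarrow> j \<in> I \<Longrightarrow> i \<noteq> j \<Longrightarrow> N i \<inter> N j = {}"
  shows "card I * d \<le> card T"
proof -
  have fin: "finite T"
    using T finite_edges[OF G] finite_subset by (auto simp: transversal_set_def)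
  have "card I * d = (\<Sum>i\<in>I. d)"
    by simp
  also have "\<dots> \<le> (\<Sum>i\<in>I. card (T \<inter> N i))"
    using T N by (intro sum_mono) (auto simp: transversal_set_def)
  also have "\<dots> = card (\<Union>i\<in>I. T \<inter> N i)"
    using I fin disj by (intro card_UN_disjoint[symmetric]) auto
  also have "\<dots> \<le> card T"
    using fin by (intro card_mono) auto
  finally show ?thesis .
qed

lemma transversal_number_eqI:
  assumes G: "finite_simple_graph G" and T: "transversal_set G d T" "card T = n"
    and ge: "\<And>T'. transversal_set G d T' \<Longrightarrow> n \<le> card T'"
  shows "transversal_number d G = n"
  unfolding transversal_number_def
proof (rule Min_eqI)
  have "finite {T. transversal_set G d T}"
    using finite_edges[OF G]
    by (rule finite_subset[rotated, OF finite_Pow_iff[THEN iffD2]])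
      (auto simp: transversal_set_def)
  then show "finite (card ` {T. transversal_set G d T})"
    by simp
qed (use T ge in auto)

lemma card_Int_Un_ge:
  assumes "a \<le> card (A \<inter> M)" "b \<le> card (B \<inter> M)" "A \<inter> B = {}" "finite M"
  shows "a + b \<le> card ((A \<union> B) \<inter> M)"
proof -
  have "card ((A \<union> B) \<inter> M) = card (A \<inter> M) + card (B \<inter> M)"
    unfolding Int_Un_distrib2 using assms(3,4) by (intro card_Un_disjoint) auto
  with assms show ?thesis by simp
qed

section \<open>The edges of the product of a path and a triangle\<close>

abbreviation triangular_tube :: "nat \<Rightarrow> (nat \<times> nat) ugraph" where
  "triangular_tube m \<equiv> path_graph m \<box> cycle_graph 3"

definition rung :: "nat \<Rightarrow> nat \<Rightarrow> (nat \<times> nat) set" where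
  "rung j i = {j, Suc j} \<times> {i}"

text \<open>Naming an edge of a triangle by the vertex it misses makes the perfect matchings
  \<open>slice_matching\<close> below consist of edges with one common index \<open>i\<close>.\<close>

definition side :: "nat \<Rightarrow> nat \<Rightarrow> (nat \<times> nat) set" where
  "side j i = {j} \<times> ({..<3} - {i})"

definition ladder :: "nat \<Rightarrow> (nat \<times> nat) set set" where
  "ladder j = rung j ` {..<3}"

definition triangle :: "nat \<Rightarrow> (nat \<times> nat) set set" where
  "triangle j = side j ` {..<3}"

lemma lessThan_3: "{..<3} = {0, 1, 2 :: nat}"
  by auto

lemma rung_eq_iff [simp]: "rung j i = rung j' i' \<longleftrightarrow> j = j' \<and> i = i'"
proof
  assume eq: "rung j i = rung j' i'"
  have "(j, i) \<in> rung j' i'" "(j', i') \<in> rung j i"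
    using eq by (auto simp: rung_def)
  moreover have "(Suc j, i) \<in> rung j' i'" "(Suc j', i') \<in> rung j i"
    using eq by (auto simp: rung_def)
  ultimately show "j = j' \<and> i = i'"
    by (auto simp: rung_def)
qed simp

lemma side_eq_iff [simp]:
  assumes "i < 3" "i' < 3"
  shows "side j i = side j' i' \<longleftrightarrow> j = j' \<and> i = i'"
proof
  assume eq: "side j i = side j' i'"
  have "{..<3} - {i} \<noteq> {}"
    using assms(1) by (auto simp: lessThan_3)
  then have "j = j'" and "{..<3} - {i} = {..<3} - {i'}"
    using eq by (auto simp: side_def times_eq_iff)
  with assms show "j = j' \<and> i = i'"
    by blast
qed simp

lemma rung_neq_side [simp]: "rung j i \<noteq> side j' i'" "side j' i' \<noteq> rung j i"
proof -
  show "rung j i \<noteq> side j' i'"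
  proof
    assume eq: "rung j i = side j' i'"
    have "(j, i) \<in> side j' i'" "(Suc j, i) \<in> side j' i'"
      unfolding eq[symmetric] by (simp_all add: rung_def)
    then show False
      by (simp add: side_def)
  qed
  then show "side j' i' \<noteq> rung j i"
    by metis
qed

lemma verts_tube: "verts (triangular_tube m) = {..<m} \<times> {..<3}"
  by (simp add: cartesian_product_def path_graph_def cycle_graph_def)

lemma edges_path: "edges (path_graph m) = (\<lambda>j. {j, Suc j}) ` {j. Suc j < m}"
  by (auto simp: path_graph_def)

lemma edges_triangle: "edges (cycle_graph 3) = (\<lambda>i. {..<3} - {i}) ` {..<3}"
proof -
  have "edges (cycle_graph 3) = (\<lambda>i. {i, Suc i mod 3}) ` {..<3}"
    by (auto simp: cycle_graph_def)
  also have "\<dots> = {{0, 1}, {1, 2}, {2, 0}}"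
    by (simp add: lessThan_3 numeral_2_eq_2)
  also have "\<dots> = {{1, 2}, {0, 2}, {0, 1}}"
    by (simp add: insert_commute)
  also have "\<dots> = (\<lambda>i. {..<3} - {i}) ` {..<3}"
    by (auto simp: lessThan_3 insert_Diff_if)
  finally show ?thesis .
qed

lemma cartesian_product_edgeI:
  assumes "(g1, h1) \<in> verts G \<times> verts H" "(g2, h2) \<in> verts G \<times> verts H"
    and "g1 = g2 \<and> {h1, h2} \<in> edges H \<or> {g1, g2} \<in> edges G \<and> h1 = h2"
  shows "{(g1, h1), (g2, h2)} \<in> edges (G \<box> H)"
  using assms unfolding cartesian_product_def ugraph.simps mem_Collect_eq by metis

lemma edges_tube:
  "edges (triangular_tube m) = (\<Union>j\<in>{j. Suc j < m}. ladder j) \<union> (\<Union>j\<in>{..<m}. triangle j)"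
  (is "?E = ?R \<union> ?S")
proof (intro equalityI subsetI)
  fix e assume "e \<in> ?E"
  then obtain g1 h1 g2 h2 where e: "e = {(g1, h1), (g2, h2)}"
    and "(g1, h1) \<in> verts (path_graph m) \<times> verts (cycle_graph 3)"
    and adj: "g1 = g2 \<and> {h1, h2} \<in> edges (cycle_graph 3) \<or>
      {g1, g2} \<in> edges (path_graph m) \<and> h1 = h2"
    unfolding cartesian_product_def ugraph.simps mem_Collect_eq by metis
  then have v: "g1 < m" "h1 < 3"
    by (simp_all add: path_graph_def cycle_graph_def)
  from adj show "e \<in> ?R \<union> ?S"
  proof
    assume *: "g1 = g2 \<and> {h1, h2} \<in> edges (cycle_graph 3)"
    then obtain i where i: "i < 3" "{h1, h2} = {..<3} - {i}"
      unfolding edges_triangle by auto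
    have "e = {g1} \<times> {h1, h2}"
      using e * by auto
    then have "e = side g1 i"
      using i by (simp add: side_def)
    then show ?thesis
      using v i by (auto simp: triangle_def)
  next
    assume *: "{g1, g2} \<in> edges (path_graph m) \<and> h1 = h2"
    then obtain j where j: "Suc j < m" "{g1, g2} = {j, Suc j}"
      unfolding edges_path by auto
    have "e = {g1, g2} \<times> {h1}"
      using e * by auto
    then have "e = rung j h1"
      using j by (simp add: rung_def)
    then show ?thesis
      using v j by (auto simp: ladder_def)
  qed
next
  fix e assume "e \<in> ?R \<union> ?S"
  then consider j i where "Suc j < m" "i < 3" "e = rung j i"
    | j i where "j < m" "i < 3" "e = side j i"
    by (auto simp: ladder_def triangle_def)
  then show "e \<in> ?E"
  proof cases
    case 1
    then have "e = {(j, i), (Suc j, i)}" "{j, Suc j} \<in> edges (path_graph m)"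
      by (auto simp: rung_def edges_path)
    with 1 show ?thesis
      using cartesian_product_edgeI[of j i "path_graph m" "cycle_graph 3" "Suc j" i]
      by (simp add: path_graph_def cycle_graph_def)
  next
    case 2
    have "{..<3} - {i} \<in> edges (cycle_graph 3)"
      using 2 by (auto simp: edges_triangle)
    moreover obtain h1 h2 where h: "{..<3} - {i} = {h1, h2}" "h1 < 3" "h2 < 3"
    proof -
      have "card ({..<3} - {i}) = 2"
        using 2 by simp
      then obtain h1 h2 where "{..<3} - {i} = {h1, h2}"
        by (auto simp: card_2_iff)
      then show thesis
        using that[of h1 h2] by blast
    qed
    ultimately have "{h1, h2} \<in> edges (cycle_graph 3)" "e = {(j, h1), (j, h2)}"
      using 2 by (auto simp: side_def)
    with 2 h(2,3) show ?thesis
      using cartesian_product_edgeI[of j h1 "path_graph m" "cycle_graph 3" j h2]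
      by (simp add: path_graph_def cycle_graph_def)
  qed
qed

lemma simple_tube: "finite_simple_graph (triangular_tube m)"
  by (intro finite_simple_graph_cartesian_product finite_simple_graph_path
      finite_simple_graph_cycle) simp

lemma card_ladder: "card (ladder j) = 3"
  by (simp add: ladder_def card_image inj_on_def)

lemma card_triangle: "card (triangle j) = 3"
  by (simp add: triangle_def card_image inj_on_def)

lemma finite_ladder: "finite (ladder j)" and finite_triangle: "finite (triangle j)"
  by (simp_all add: ladder_def triangle_def)

lemma ladder_disjoint: "j \<noteq> j' \<Longrightarrow> ladder j \<inter> ladder j' = {}"
  by (auto simp: ladder_def)

lemma triangle_disjoint: "j \<noteq> j' \<Longrightarrow> triangle j \<inter> triangle j' = {}"
  by (auto simp: triangle_def)

lemma ladder_triangle_disjoint: "ladder j \<inter> triangle j' = {}"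
  by (auto simp: ladder_def triangle_def)

section \<open>Three disjoint perfect matchings\<close>

definition slice_matching :: "nat \<Rightarrow> nat \<Rightarrow> (nat \<times> nat) set set" where
  "slice_matching n i = (\<lambda>k. rung (2 * k) i) ` {..<n} \<union> (\<lambda>j. side j i) ` {..<2 * n}"

lemma matching_slice:
  assumes "i < 3"
  shows "matching (triangular_tube (2 * n)) (slice_matching n i)"
proof -
  have sub: "slice_matching n i \<subseteq> edges (triangular_tube (2 * n))"
    using assms by (force simp: slice_matching_def edges_tube ladder_def triangle_def)
  have rungs: "rung (2 * k) i \<inter> rung (2 * l) i = {}" if "k \<noteq> l" for k l
    using that by (auto simp: rung_def)
  have mixed: "rung j i \<inter> side j' i = {}" "side j' i \<inter> rung j i = {}" for j j'
    by (auto simp: rung_def side_def)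
  have sides: "side j i \<inter> side j' i = {}" if "j \<noteq> j'" for j j'
    using that by (auto simp: side_def)
  have "e \<inter> f = {}" if "e \<in> slice_matching n i" "f \<in> slice_matching n i" "e \<noteq> f" for e f
    using that assms unfolding slice_matching_def
    by (elim UnE imageE) (simp_all add: rungs mixed sides)
  with sub show ?thesis
    by (simp add: matching_def)
qed

lemma Union_slice:
  assumes "i < 3"
  shows "\<Union>(slice_matching n i) = verts (triangular_tube (2 * n))"
proof (intro equalityI subsetI)
  fix v assume v: "v \<in> verts (triangular_tube (2 * n))"
  obtain j h where jh: "v = (j, h)" "j < 2 * n" "h < 3"
    using v by (auto simp: verts_tube)
  show "v \<in> \<Union>(slice_matching n i)"
  proof (cases "h = i")
    case True
    then have "v \<in> rung (2 * (j div 2)) i"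
      using jh by (auto simp: rung_def)
    moreover have "j div 2 < n"
      using jh by linarith
    ultimately show ?thesis
      by (auto simp: slice_matching_def)
  next
    case False
    then have "v \<in> side j i"
      using jh by (auto simp: side_def)
    then show ?thesis
      using jh by (auto simp: slice_matching_def)
  qed
qed (use Union_matching_subset[OF simple_tube matching_slice[OF assms]] in blast)

lemma slice_disjoint:
  "i < 3 \<Longrightarrow> i' < 3 \<Longrightarrow> i \<noteq> i' \<Longrightarrow> slice_matching n i \<inter> slice_matching n i' = {}"
  by (auto simp: slice_matching_def)

lemma maximum_matching_tube_iff:
  "maximum_matching (triangular_tube (2 * n)) M \<longleftrightarrow>
    matching (triangular_tube (2 * n)) M \<and> \<Union>M = verts (triangular_tube (2 * n))"
  using maximum_matching_iff_perfect(1)[OF simple_tube matching_slice[of 0] Union_slice[of 0]]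
  by simp

lemma matching_number_tube: "matching_number (triangular_tube (2 * n)) = 3 * n"
  using maximum_matching_iff_perfect(2)[OF simple_tube matching_slice[of 0] Union_slice[of 0]]
  by (simp add: verts_tube)

section \<open>Edges that every perfect matching must use\<close>

text \<open>The layers \<open>0, \<dots>, j\<close> contain \<open>3 * (j + 1)\<close> vertices, an odd number, and the ladder at
  \<open>j\<close> is the set of edges leaving them.\<close>

lemma perfect_matching_meets_even_ladder:
  assumes M: "matching (triangular_tube m) M" "\<Union>M = verts (triangular_tube m)"
    and j: "even j" "j < m"
  shows "1 \<le> card (ladder j \<inter> M)"
proof -
  define W where "W = {..j} \<times> {..<3::nat}"
  have "odd (card W)"
    using j by (simp add: W_def)
  moreover have "W \<subseteq> verts (triangular_tube m)"
    using j by (auto simp: W_def verts_tube)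
  ultimately have "\<exists>e\<in>M. e \<inter> W \<noteq> {} \<and> \<not> e \<subseteq> W"
    using perfect_matching_crosses_odd_set[OF simple_tube M] by simp
  then obtain e where e: "e \<in> M" "e \<inter> W \<noteq> {}" "\<not> e \<subseteq> W"
    by (elim bexE conjE)
  have "e \<in> ladder j"
  proof -
    have "e \<in> edges (triangular_tube m)"
      using e M(1) by (auto simp: matching_def)
    then consider l i where "i < 3" "e = rung l i" | l i where "e = side l i"
      by (auto simp: edges_tube ladder_def triangle_def)
    then show ?thesis
    proof cases
      case 1
      then have "l = j"
        using e(2,3) by (auto simp: W_def rung_def)
      with 1 show ?thesis
        by (auto simp: ladder_def)
    next
      case 2
      then show ?thesis
        using e(2,3) by (auto simp: W_def side_def)
    qed
  qed
  with e have "ladder j \<inter> M \<noteq> {}"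
    by blast
  then show ?thesis
    using finite_ladder[of j] by (simp add: Suc_le_eq card_gt_0_iff)
qed

text \<open>One edge covers at most two of the three vertices of a layer; at an end of the tube, the
  edges available to cover them are six.\<close>

lemma perfect_matching_uses_two_end_edges:
  assumes M: "matching (triangular_tube m) M" "\<Union>M = verts (triangular_tube m)"
    and j: "j < m"
    and ends: "j = 0 \<and> l = 0 \<or> Suc j = m \<and> Suc l = j"
  shows "2 \<le> card ((ladder l \<union> triangle j) \<inter> M)"
proof -
  define W where "W = {j} \<times> {..<3::nat}"
  have "{e \<in> M. e \<inter> W \<noteq> {}} \<subseteq> (ladder l \<union> triangle j) \<inter> M"
  proof
    fix e assume e: "e \<in> {e \<in> M. e \<inter> W \<noteq> {}}"
    then have "e \<in> edges (triangular_tube m)"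
      using M(1) by (auto simp: matching_def)
    then consider l' i where "Suc l' < m" "i < 3" "e = rung l' i"
      | j' i where "i < 3" "e = side j' i"
      by (auto simp: edges_tube ladder_def triangle_def)
    then show "e \<in> (ladder l \<union> triangle j) \<inter> M"
    proof cases
      case 1
      then have "l' = l"
        using e ends by (auto simp: W_def rung_def)
      with 1 e show ?thesis
        by (auto simp: ladder_def)
    next
      case 2
      then have "j' = j"
        using e by (auto simp: W_def side_def)
      with 2 e show ?thesis
        by (auto simp: triangle_def)
    qed
  qed
  then have "card {e \<in> M. e \<inter> W \<noteq> {}} \<le> card ((ladder l \<union> triangle j) \<inter> M)"
    by (intro card_mono) (simp_all add: finite_ladder finite_triangle)
  moreover have "card W \<le> 2 * card {e \<in> M. e \<inter> W \<noteq> {}}"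
    using j by (intro perfect_matching_covers[OF simple_tube M]) (auto simp: W_def verts_tube)
  moreover have "card W = 3"
    by (simp add: W_def)
  ultimately show ?thesis
    by linarith
qed

definition even_ladders :: "nat set \<Rightarrow> (nat \<times> nat) set set" where
  "even_ladders K = (\<Union>k\<in>K. ladder (2 * k))"

lemma even_ladders_disjoint_ladder: "k \<notin> K \<Longrightarrow> even_ladders K \<inter> ladder (2 * k) = {}"
  by (auto simp: even_ladders_def ladder_def)

lemma even_ladders_disjoint_triangle: "even_ladders K \<inter> triangle j = {}"
  by (auto simp: even_ladders_def ladder_def triangle_def)

lemma finite_even_ladders: "finite K \<Longrightarrow> finite (even_ladders K)"
  by (simp add: even_ladders_def finite_ladder)

lemma card_even_ladders: "finite K \<Longrightarrow> card (even_ladders K) = 3 * card K"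
  unfolding even_ladders_def
  by (subst card_UN_disjoint) (simp_all add: finite_ladder ladder_disjoint card_ladder)

lemma even_ladders_subset:
  "K \<subseteq> {..<n} \<Longrightarrow> even_ladders K \<subseteq> edges (triangular_tube (2 * n))"
  by (force simp: even_ladders_def edges_tube)

lemma perfect_matching_meets_even_ladders:
  assumes M: "matching (triangular_tube (2 * n)) M" "\<Union>M = verts (triangular_tube (2 * n))"
    and K: "K \<subseteq> {..<n}"
  shows "card K \<le> card (even_ladders K \<inter> M)"
proof -
  have "finite K"
    using K finite_subset by blast
  have "card K = (\<Sum>k\<in>K. 1)"
    by simp
  also have "\<dots> \<le> (\<Sum>k\<in>K. card (ladder (2 * k) \<inter> M))"
    using K by (intro sum_mono perfect_matching_meets_even_ladder[OF M]) auto
  also have "\<dots> = card (\<Union>k\<in>K. ladder (2 * k) \<inter> M)"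
    using \<open>finite K\<close>
    by (intro card_UN_disjoint[symmetric]) (auto simp: finite_ladder ladder_def)
  also have "(\<Union>k\<in>K. ladder (2 * k) \<inter> M) = even_ladders K \<inter> M"
    by (auto simp: even_ladders_def)
  finally show ?thesis .
qed

section \<open>The transversal number\<close>

lemma tube_has_small_transversal_set:
  assumes n: "n \<ge> 2" and d: "1 \<le> d" "d \<le> n + 2"
  shows "\<exists>T. transversal_set (triangular_tube (2 * n)) d T \<and> card T = 3 * d"
proof -
  let ?G = "triangular_tube (2 * n)"
  let ?perfect = "\<lambda>M. matching ?G M \<and> \<Union>M = verts ?G"
  have number: "d \<le> matching_number ?G"
    using n d by (simp add: matching_number_tube)
  have transversalI: "transversal_set ?G d T"
    if "T \<subseteq> edges ?G" "\<And>M. ?perfect M \<Longrightarrow> d \<le> card (T \<inter> M)" for T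
    using that d number by (auto simp: transversal_set_def maximum_matching_tube_iff)
  \<comment> \<open>\<open>A\<close> and \<open>B\<close> are the edges at the two ends. The ladder in \<open>B\<close> is the last one starting in an
    even layer; for \<open>n \<ge> 2\<close> it differs from the ladder in \<open>A\<close>, so the two sets are disjoint.\<close>
  define A where "A = ladder (2 * 0) \<union> triangle 0"
  define B where "B = ladder (2 * (n - 1)) \<union> triangle (2 * n - 1)"
  have sub: "A \<subseteq> edges ?G" "B \<subseteq> edges ?G"
    using n by (auto simp: A_def B_def edges_tube)
  have card_AB: "card A = 6" "card B = 6" and fin: "finite A" "finite B"
    by (auto simp: A_def B_def card_Un_disjoint finite_ladder finite_triangle card_ladder
        card_triangle ladder_triangle_disjoint)
  have A2: "2 \<le> card (A \<inter> M)" if "?perfect M" for M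
    using perfect_matching_uses_two_end_edges[of "2 * n" M 0 0] that n by (simp add: A_def)
  have B2: "2 \<le> card (B \<inter> M)" if "?perfect M" for M
    using perfect_matching_uses_two_end_edges[of "2 * n" M "2 * n - 1" "2 * (n - 1)"] that n
    by (simp add: B_def Suc_diff_Suc numeral_2_eq_2)
  have AB: "A \<inter> B = {}"
    using n ladder_disjoint[of 0 "2 * (n - 1)"] triangle_disjoint[of 0 "2 * n - 1"]
      ladder_triangle_disjoint
    unfolding A_def B_def by (auto; fastforce)
  have LA: "even_ladders K \<inter> A = {}" if "0 \<notin> K" for K
    using even_ladders_disjoint_ladder[OF that] even_ladders_disjoint_triangle[of K 0]
    by (auto simp: A_def)
  have LB: "even_ladders K \<inter> B = {}" if "n - 1 \<notin> K" for K
    using even_ladders_disjoint_ladder[OF that] even_ladders_disjoint_triangle[of K]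
    unfolding B_def by blast
  have finM: "finite M" if "?perfect M" for M
    using that finite_matching[OF simple_tube] by blast
  consider "d \<le> n" | "d = n + 1" | "d = n + 2"
    using d by linarith
  then show ?thesis
  proof cases
    case 1
    have K: "{..<d} \<subseteq> {..<n}"
      using 1 by auto
    show ?thesis
    proof (intro exI conjI transversalI)
      show "even_ladders {..<d} \<subseteq> edges ?G"
        using K by (rule even_ladders_subset)
      show "d \<le> card (even_ladders {..<d} \<inter> M)" if "?perfect M" for M
        using perfect_matching_meets_even_ladders[of n M, OF _ _ K] that by simp
      show "card (even_ladders {..<d}) = 3 * d"
        by (simp add: card_even_ladders)
    qed
  next
    case 2
    define K where "K = {1..<n}"
    \<comment> \<open>The ladder at \<open>0\<close> is already part of \<open>A\<close>, whose two edges are counted separately.\<close>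
    have K: "K \<subseteq> {..<n}" "0 \<notin> K" "finite K" "card K + 2 = d"
      using n 2 by (auto simp: K_def)
    show ?thesis
    proof (intro exI conjI transversalI)
      show "even_ladders K \<union> A \<subseteq> edges ?G"
        using even_ladders_subset[OF K(1)] sub by blast
      show "d \<le> card ((even_ladders K \<union> A) \<inter> M)" if "?perfect M" for M
        using card_Int_Un_ge[OF perfect_matching_meets_even_ladders[of n M, OF _ _ K(1)]
            A2[OF that] LA[OF K(2)] finM[OF that]] that K(4) by simp
      show "card (even_ladders K \<union> A) = 3 * d"
        using K(3,4) LA[OF K(2)] card_AB fin
        by (simp add: card_Un_disjoint finite_even_ladders card_even_ladders)
    qed
  next
    case 3
    define K where "K = {1..<n - 1}"
    have K: "K \<subseteq> {..<n}" "0 \<notin> K" "n - 1 \<notin> K" "finite K" "card K + 4 = d"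
      using n 3 by (auto simp: K_def)
    have disj: "even_ladders K \<inter> (A \<union> B) = {}"
      using LA[OF K(2)] LB[OF K(3)] by blast
    show ?thesis
    proof (intro exI conjI transversalI)
      show "even_ladders K \<union> (A \<union> B) \<subseteq> edges ?G"
        using even_ladders_subset[OF K(1)] sub by blast
      show "d \<le> card ((even_ladders K \<union> (A \<union> B)) \<inter> M)" if "?perfect M" for M
        using card_Int_Un_ge[OF perfect_matching_meets_even_ladders[of n M, OF _ _ K(1)]
            card_Int_Un_ge[OF A2[OF that] B2[OF that] AB finM[OF that]] disj finM[OF that]]
          that K(5) by simp
      show "card (even_ladders K \<union> (A \<union> B)) = 3 * d"
        using K(4,5) disj AB card_AB fin
        by (simp add: card_Un_disjoint finite_even_ladders card_even_ladders)
    qed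
  qed
qed

theorem lemma3p13:
  fixes m d :: nat
  assumes "m \<ge> 4" and "even m" and "1 \<le> d" and "d \<le> m div 2 + 2"
  shows "transversal_number d (path_graph m \<box> cycle_graph 3) = 3 * d"
proof -
  obtain n where m: "m = 2 * n"
    using \<open>even m\<close> by blast
  obtain T where T: "transversal_set (triangular_tube m) d T" "card T = 3 * d"
    using tube_has_small_transversal_set[of n d] assms m by auto
  show ?thesis
  proof (rule transversal_number_eqI[OF simple_tube T])
    fix T' assume T': "transversal_set (triangular_tube m) d T'"
    have "card {..<3::nat} * d \<le> card T'"
    proof (rule card_transversal_set_ge[OF simple_tube T'])
      show "maximum_matching (triangular_tube m) (slice_matching n i)" if "i \<in> {..<3}" for i
        using that matching_slice[of i n] Union_slice[of i n]
        by (simp add: m maximum_matching_tube_iff)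
    qed (simp_all add: slice_disjoint)
    then show "3 * d \<le> card T'"
      by simp
  qed
qed

end
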